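(* Let $n\ge 1$ be an integer and let $(X,\|\cdot\|)$ be a real normed space of dimension $d\ge n$ which satisfies property (G). Then the $n$-dual space of $(X,\|\cdot,\ldots,\cdot\|_G)$, with the norm $\|\cdot\|_{n,n}$, is a Banach space.
   Context: Let $X$ be a real normed space with norm $\|\cdot\|$ (its dimension may be infinite; $X$ is not assumed complete), and let $X^{(1)}$ denote its usual dual space of bounded linear functionals. Gähler $n$-norm: for $x_1,\ldots,x_n\in X$, $$\|x_1,\ldots,x_n\|_G:=\sup\left\{\left|\det[f_j(x_i)]_{i,j}\right| : f_1,\ldots,f_n\in X^{(1)},\ \|f_i\|\le 1\right\}.$$ It vanishes exactly when $x_1,\ldots,x_n$ are linearly dependent. $n$-dual space of $(X,\|\cdot,\ldots,\cdot\|_G)$: an $n$-functional on $X$ is a function $f:X^n\to\mathbb{R}$; it is multilinear if it is linear in each variable separately, and bounded on $(X,\|\cdot,\ldots,\cdot\|_G)$ if there is $K>0$ with $|f(x_1,\ldots,x_n)|\le K\|x_1,\ldots,x_n\|_G$ for all $x_1,\ldots,x_n\in X$. The $n$-dual space of $(X,\|\cdot,\ldots,\cdot\|_G)$ is the vector space of all multilinear $n$-functionals bounded on $(X,\|\cdot,\ldots,\cdot\|_G)$, with pointwise operations and the norm $$\|f\|_{n,n}:=\sup_{\|x_1,\ldots,x_n\|_G\ne 0}\frac{|f(x_1,\ldots,x_n)|}{\|x_1,\ldots,x_n\|_G}.$$ Property (G): define $g:X^2\to\mathbb{R}$ by $g(x,y):=\frac{\|x\|}{2}\left(\tau_-(x,y)+\tau_+(x,y)\right)$,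 where $\tau_\pm(x,y):=\lim_{t\to\pm 0}t^{-1}(\|x+ty\|-\|x\|)$ (one-sided limits at $0$). $X$ satisfies property (G) if, for every $x\in X$, the map $y\mapsto g(x,y)$ is linear. *)

theory Defs
  imports "HOL-Analysis.Analysis" "HOL-Library.Function_Algebras" "HOL-Library.Extended_Nat"
begin

text \<open>
  Banach spaces carried by a subset \<open>V\<close> of an ambient real vector space with scalar
  multiplication \<open>scale\<close>; the norm \<open>N\<close> is only meaningful on \<open>V\<close>.
\<close>

locale normed_space_on = vector_space scale
  for scale :: "real \<Rightarrow> 'v::ab_group_add \<Rightarrow> 'v" +
  fixes V :: "'v set" and N :: "'v \<Rightarrow> real"
  assumes subspace_carrier: "subspace V"
    and norm_nonneg: "v \<in> V \<Longrightarrow> 0 \<le> N v"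
    and norm_eq_0_iff: "v \<in> V \<Longrightarrow> N v = 0 \<longleftrightarrow> v = 0"
    and norm_scale: "v \<in> V \<Longrightarrow> N (scale c v) = \<bar>c\<bar> * N v"
    and norm_triangle: "u \<in> V \<Longrightarrow> v \<in> V \<Longrightarrow> N (u + v) \<le> N u + N v"

locale banach_space_on = normed_space_on scale V N
  for scale :: "real \<Rightarrow> 'v::ab_group_add \<Rightarrow> 'v" and V N +
  assumes norm_complete:
    "\<forall>k. \<sigma> k \<in> V \<Longrightarrow>
     \<forall>e>0. \<exists>K::nat. \<forall>k\<ge>K. \<forall>l\<ge>K. N (\<sigma> k - \<sigma> l) < e \<Longrightarrow>
     \<exists>v\<in>V. (\<lambda>k. N (\<sigma> k - v)) \<longlonglongrightarrow> 0"

text \<open>The algebraic dimension, \<open>\<infinity>\<close> if there is no finite spanning set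
  (in which case \<^const>\<open>dim\<close> is 0).\<close>

definition space_dim :: "'a::real_vector itself \<Rightarrow> enat" where
  "space_dim _ =
     (if \<exists>B::'a set. finite B \<and> span B = UNIV then enat (dim (UNIV :: 'a set)) else \<infinity>)"

text \<open>Tuples in \<open>X\<^sup>n\<close> are functions from a finite index type \<open>'n\<close> with \<open>n = CARD('n)\<close>.
  The set below is bounded above, so the real \<^const>\<open>Sup\<close> is a genuine supremum.\<close>

definition gaehler_norm :: "('n::finite \<Rightarrow> 'a::real_normed_vector) \<Rightarrow> real" where
  "gaehler_norm x =
     Sup {\<bar>det (\<chi> i j. blinfun_apply (f j) (x i) :: real^'n^'n)\<bar> | f :: 'n \<Rightarrow> 'a \<Rightarrow>\<^sub>L real.
            \<forall>i. norm (f i) \<le> 1}"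

definition multilinear :: "(('n::finite \<Rightarrow> 'a::real_vector) \<Rightarrow> real) \<Rightarrow> bool" where
  "multilinear f \<longleftrightarrow> (\<forall>x i. linear (\<lambda>y. f (x(i := y))))"

definition gaehler_bounded :: "(('n::finite \<Rightarrow> 'a::real_normed_vector) \<Rightarrow> real) \<Rightarrow> bool" where
  "gaehler_bounded f \<longleftrightarrow> (\<exists>K>0. \<forall>x. \<bar>f x\<bar> \<le> K * gaehler_norm x)"

definition n_dual :: "(('n::finite \<Rightarrow> 'a::real_normed_vector) \<Rightarrow> real) set" where
  "n_dual = {f. multilinear f \<and> gaehler_bounded f}"

text \<open>Meaningful for bounded \<open>f\<close> and spaces of dimension at least \<open>n\<close>; otherwise the
  supremum is over an unbounded or empty set.\<close>

definition n_dual_norm :: "(('n::finite \<Rightarrow> 'a::real_normed_vector) \<Rightarrow> real) \<Rightarrow> real" where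
  "n_dual_norm f = Sup {\<bar>f x\<bar> / gaehler_norm x | x. gaehler_norm x \<noteq> 0}"

text \<open>The one-sided limits always exist, by convexity of the norm.\<close>

definition tau_plus :: "'a::real_normed_vector \<Rightarrow> 'a \<Rightarrow> real" where
  "tau_plus x y = Lim (at_right 0) (\<lambda>t. (norm (x + t *\<^sub>R y) - norm x) / t)"

definition tau_minus :: "'a::real_normed_vector \<Rightarrow> 'a \<Rightarrow> real" where
  "tau_minus x y = Lim (at_left 0) (\<lambda>t. (norm (x + t *\<^sub>R y) - norm x) / t)"

definition g_functional :: "'a::real_normed_vector \<Rightarrow> 'a \<Rightarrow> real" where
  "g_functional x y = norm x / 2 * (tau_minus x y + tau_plus x y)"

definition property_G :: "'a::real_normed_vector itself \<Rightarrow> bool" where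
  "property_G _ \<longleftrightarrow> (\<forall>x::'a. linear (g_functional x))"

end

theory Submission
  imports Defs
begin

text \<open>
  A bounded \<open>n\<close>-functional satisfies \<open>\<bar>f x\<bar> \<le> \<parallel>f\<parallel> \<parallel>x\<parallel>\<^sub>G\<close>, so a Cauchy sequence of them converges
  pointwise, and its limit is multilinear, bounded, and a limit in norm. The one delicate point
  is that the norm is a supremum over a nonempty set, i.e. that some tuple has nonzero
  Gaehler norm. For this the dual space must separate points; property (G) supplies the
  functionals \<open>g(x, \<cdot>)\<close>, which are bounded and satisfy \<open>g(x, x) = \<parallel>x\<parallel>\<^sup>2\<close>, so that no
  Hahn--Banach theorem is needed. Separation of points makes the evaluation map from the dual
  into \<open>\<real>\<^sup>n\<close> at \<open>n\<close> independent vectors surjective, which yields a biorthogonal system.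
\<close>

section \<open>The functionals given by property (G)\<close>

text \<open>Convexity of the norm: \<open>x + s y\<close> is the convex combination of
  \<open>x\<close> and \<open>x + t y\<close> with weight \<open>s / t\<close> on the
  latter.\<close>

lemma norm_diff_quotient_mono:
  fixes x y :: "'a::real_normed_vector"
  assumes "0 < s" "s \<le> t"
  shows "(norm (x + s *\<^sub>R y) - norm x) / s \<le> (norm (x + t *\<^sub>R y) - norm x) / t"
proof -
  define u where "u = s / t"
  have u: "0 < u" "u \<le> 1" "s = u * t" using assms by (auto simp: u_def)
  have "x + s *\<^sub>R y = (1 - u) *\<^sub>R x + u *\<^sub>R (x + t *\<^sub>R y)"
    using u by (simp add: algebra_simps)
  then have "norm (x + s *\<^sub>R y) \<le> norm ((1 - u) *\<^sub>R x) + norm (u *\<^sub>R (x + t *\<^sub>R y))"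
    by (metis norm_triangle_ineq)
  also have "\<dots> = (1 - u) * norm x + u * norm (x + t *\<^sub>R y)"
    using u by simp
  finally have "norm (x + s *\<^sub>R y) - norm x \<le> u * (norm (x + t *\<^sub>R y) - norm x)"
    by (simp add: algebra_simps)
  then have "(norm (x + s *\<^sub>R y) - norm x) / s \<le> u * (norm (x + t *\<^sub>R y) - norm x) / s"
    using assms by (simp add: divide_right_mono)
  also have "\<dots> = (norm (x + t *\<^sub>R y) - norm x) / t"
    using assms by (simp add: u_def)
  finally show ?thesis .
qed

lemma abs_norm_diff_quotient_le:
  fixes x y :: "'a::real_normed_vector"
  shows "\<bar>(norm (x + t *\<^sub>R y) - norm x) / t\<bar> \<le> norm y"
proof (cases "t = 0")
  case False
  have "\<bar>norm (x + t *\<^sub>R y) - norm x\<bar> \<le> \<bar>t\<bar> * norm y"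
    using norm_triangle_ineq3[of "x + t *\<^sub>R y" x] by simp
  then show ?thesis using False by (simp add: field_simps)
qed simp

text \<open>\<open>Lim\<close> says something only once a limit is known to exist. For
  \<open>t > 0\<close> the quotient is monotone in \<open>t\<close> and bounded below by
  \<open>- norm y\<close>, so it tends to its infimum as \<open>t\<close> decreases to 0.\<close>

lemma tau_plus_tendsto:
  fixes x y :: "'a::real_normed_vector"
  shows "((\<lambda>t. (norm (x + t *\<^sub>R y) - norm x) / t) \<longlongrightarrow> tau_plus x y) (at_right 0)"
proof -
  define q where "q t = (norm (x + t *\<^sub>R y) - norm x) / t" for t
  define L where "L = Inf (q ` {0<..})"
  have bdd: "bdd_below (q ` {0<..})"
    using abs_norm_diff_quotient_le[of x _ y]
    by (intro bdd_belowI2[of _ "- norm y"]) (simp add: q_def abs_le_iff minus_le_iff del: abs_divide)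
  have "(q \<longlongrightarrow> L) (at_right 0)"
  proof (rule order_tendstoI)
    fix a assume "a < L"
    then have "a < q t" if "t > 0" for t
      using cInf_lower[OF _ bdd, of "q t"] that unfolding L_def by fastforce
    then show "\<forall>\<^sub>F t in at_right 0. a < q t"
      using eventually_at_right_less by (rule eventually_mono[rotated]) simp
  next
    fix a assume "L < a"
    moreover have "q ` {0<..} \<noteq> {}" by simp
    ultimately have "\<exists>z \<in> q ` {0<..}. z < a"
      unfolding L_def by (metis cInf_lessD)
    then obtain t0 where t0: "t0 > 0" "q t0 < a" by auto
    \<comment> \<open>By monotonicity, one quotient below \<open>a\<close> forces all those at
      smaller \<open>t > 0\<close> below \<open>a\<close>.\<close>
    have "q t < a" if "0 < t" "t < t0" for t
      using norm_diff_quotient_mono[of t t0 x y] that t0 by (simp add: q_def)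
    then show "\<forall>\<^sub>F t in at_right 0. q t < a"
      using t0 by (auto simp: eventually_at_right_field)
  qed
  moreover from this have "tau_plus x y = L"
    unfolding tau_plus_def q_def[abs_def] by (intro tendsto_Lim) auto
  ultimately show ?thesis by (simp add: q_def[abs_def])
qed

lemma tau_plus_unique:
  fixes x y :: "'a::real_normed_vector"
  assumes "((\<lambda>t. (norm (x + t *\<^sub>R y) - norm x) / t) \<longlongrightarrow> l) (at_right 0)"
  shows "tau_plus x y = l"
  using tendsto_unique[OF _ tau_plus_tendsto assms] by simp

lemma abs_tau_plus_le: "\<bar>tau_plus x y\<bar> \<le> norm y"
  by (rule tendsto_upperbound[OF tendsto_rabs[OF tau_plus_tendsto]])
     (simp_all add: abs_norm_diff_quotient_le del: abs_divide)

text \<open>The substitution of \<open>- t\<close> for \<open>t\<close> turns the left limit into a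
  right limit in direction \<open>- y\<close>, so existence and bounds carry over from
  \<open>tau_plus\<close>.\<close>

lemma tau_minus_eq: "tau_minus x y = - tau_plus x (- y)"
proof -
  have "((\<lambda>t. - ((norm (x + t *\<^sub>R (- y)) - norm x) / t)) \<longlongrightarrow> - tau_plus x (- y)) (at_right 0)"
    by (intro tendsto_minus tau_plus_tendsto)
  then have "((\<lambda>t. (norm (x + t *\<^sub>R y) - norm x) / t) \<longlongrightarrow> - tau_plus x (- y)) (at_left 0)"
    unfolding filterlim_at_left_to_right[of _ _ 0] by simp
  then show ?thesis
    unfolding tau_minus_def by (intro tendsto_Lim) auto
qed

lemma abs_g_functional_le: "\<bar>g_functional x y\<bar> \<le> norm x * norm y"
proof -
  have "\<bar>tau_minus x y + tau_plus x y\<bar> \<le> 2 * norm y"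
    using abs_tau_plus_le[of x y] abs_tau_plus_le[of x "- y"] by (simp add: tau_minus_eq)
  then have "norm x / 2 * \<bar>tau_minus x y + tau_plus x y\<bar> \<le> norm x / 2 * (2 * norm y)"
    by (intro mult_left_mono) auto
  then show ?thesis by (simp add: g_functional_def abs_mult)
qed

text \<open>Along the line through \<open>x\<close> the difference quotient is constant near 0; the
  directions \<open>x\<close> and \<open>- x\<close> are treated together as \<open>c = 1\<close>
  and \<open>c = -1\<close>.\<close>

lemma g_functional_self: "g_functional x x = (norm x)\<^sup>2"
proof -
  have "tau_plus x (c *\<^sub>R x) = c * norm x" if "\<bar>c\<bar> = 1" for c
  proof (rule tau_plus_unique, rule tendsto_eventually)
    \<comment> \<open>The restriction \<open>t < 1\<close> keeps \<open>1 + t * c\<close> positive,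
      so it leaves the norm without absolute value.\<close>
    have "(norm (x + t *\<^sub>R c *\<^sub>R x) - norm x) / t = c * norm x" if "0 < t" "t < 1" for t
    proof -
      have "norm (x + t *\<^sub>R c *\<^sub>R x) = norm ((1 + t * c) *\<^sub>R x)"
        by (simp add: algebra_simps)
      also have "\<dots> = (1 + t * c) * norm x"
        using that \<open>\<bar>c\<bar> = 1\<close> by (auto simp: abs_if split: if_splits)
      finally show ?thesis using that by (simp add: field_simps)
    qed
    then show "\<forall>\<^sub>F t in at_right 0. (norm (x + t *\<^sub>R c *\<^sub>R x) - norm x) / t = c * norm x"
      by (auto simp: eventually_at_right_field intro!: exI[of _ 1])
  qed
  from this[of 1] this[of "-1"] show ?thesis
    by (simp add: g_functional_def tau_minus_eq power2_eq_square)
qed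

text \<open>Property (G) enters here: it makes \<open>g_functional x\<close> linear, hence a bounded
  functional with constant \<open>norm x\<close>, and its value at \<open>x\<close> is the square of
  \<open>norm x\<close>.\<close>

lemma property_G_separates:
  fixes x :: "'a::real_normed_vector"
  assumes "property_G TYPE('a)" "x \<noteq> 0"
  obtains f :: "'a \<Rightarrow>\<^sub>L real" where "blinfun_apply f x \<noteq> 0"
proof -
  have "bounded_linear (g_functional x)"
    using assms(1) abs_g_functional_le[of x]
    by (intro bounded_linear.intro bounded_linear_axioms.intro exI[of _ "norm x"])
       (auto simp: property_G_def mult.commute)
  then have "blinfun_apply (Blinfun (g_functional x)) x \<noteq> 0"
    using assms(2) by (simp add: bounded_linear_Blinfun_apply g_functional_self)
  then show thesis by (rule that)
qed

section \<open>The Gaehler norm\<close>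

text \<open>In the Leibniz expansion each entry in row \<open>i\<close> is at most
  \<open>norm (x i)\<close> in absolute value, so every permutation contributes at most the product
  of these norms.\<close>

lemma gaehler_bdd_above:
  fixes x :: "'n::finite \<Rightarrow> 'a::real_normed_vector"
  shows "bdd_above {\<bar>det (\<chi> i j. blinfun_apply (f j) (x i) :: real^'n^'n)\<bar> | f :: 'n \<Rightarrow> 'a \<Rightarrow>\<^sub>L real.
            \<forall>i. norm (f i) \<le> 1}"
proof (rule bdd_aboveI, clarify)
  fix f :: "'n \<Rightarrow> 'a \<Rightarrow>\<^sub>L real" assume f: "\<forall>i. norm (f i) \<le> 1"
  have le: "\<bar>f j (x i)\<bar> \<le> norm (x i)" for i j
    using norm_blinfun[of "f j" "x i"] f mult_right_mono[of "norm (f j)" 1 "norm (x i)"]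
    by fastforce
  have "\<bar>det (\<chi> i j. blinfun_apply (f j) (x i) :: real^'n^'n)\<bar>
      \<le> (\<Sum>p | p permutes (UNIV::'n set). \<bar>of_int (sign p) * (\<Prod>i\<in>UNIV. f (p i) (x i))\<bar>)"
    unfolding det_def by (simp add: sum_abs)
  also have "\<dots> \<le> (\<Sum>p | p permutes (UNIV::'n set). \<Prod>i\<in>UNIV. norm (x i))"
    by (intro sum_mono) (auto simp: abs_mult abs_prod sign_def intro!: prod_mono le)
  finally show "\<bar>det (\<chi> i j. blinfun_apply (f j) (x i) :: real^'n^'n)\<bar>
      \<le> (\<Sum>p | p permutes (UNIV::'n set). \<Prod>i\<in>UNIV. norm (x i))" .
qed

lemma abs_det_le_gaehler_norm:
  fixes x :: "'n::finite \<Rightarrow> 'a::real_normed_vector" and f :: "'n \<Rightarrow> 'a \<Rightarrow>\<^sub>L real"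
  assumes "\<And>i. norm (f i) \<le> 1"
  shows "\<bar>det (\<chi> i j. blinfun_apply (f j) (x i) :: real^'n^'n)\<bar> \<le> gaehler_norm x"
  unfolding gaehler_norm_def using assms by (intro cSup_upper gaehler_bdd_above) auto

lemma gaehler_norm_nonneg: "0 \<le> gaehler_norm x"
  using abs_det_le_gaehler_norm[of "\<lambda>_. 0" x] by (intro order_trans[OF abs_ge_zero]) auto

section \<open>Biorthogonal systems and tuples of nonzero Gaehler norm\<close>

text \<open>A basis is either finite, with as many elements as the dimension, or infinite. In both
  cases it has a subset of \<open>CARD('n)\<close> elements, which a bijection indexes by
  \<open>'n\<close>.\<close>

lemma ex_independent_family:
  assumes "space_dim TYPE('a::real_vector) \<ge> enat CARD('n::finite)"
  obtains x :: "'n::finite \<Rightarrow> 'a::real_vector" where "inj x" "independent (range x)"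
proof -
  obtain B :: "'a set" where B: "independent B" "UNIV \<subseteq> span B"
    by (rule basis_exists)
  have "\<exists>C \<subseteq> B. finite C \<and> card C = CARD('n)"
  proof (cases "finite B")
    case True
    then have "space_dim TYPE('a) = enat (card B)"
      using B dim_eq_card[of B UNIV] unfolding space_dim_def by auto
    then have "CARD('n) \<le> card B"
      using assms by simp
    then show ?thesis
      using obtain_subset_with_card_n by metis
  next
    case False
    then show ?thesis using infinite_arbitrarily_large[of B "CARD('n)"] by auto
  qed
  then obtain C where C: "C \<subseteq> B" "finite C" "card C = CARD('n)" by auto
  then obtain x :: "'n \<Rightarrow> 'a" where "bij_betw x UNIV C"
    using finite_same_card_bij[of "UNIV :: 'n set" C] by auto
  then have "inj x" "range x = C"
    by (simp_all add: bij_betw_def)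
  then show thesis
    using that independent_mono[OF B(1) C(1)] by simp
qed

text \<open>The evaluation map \<open>E\<close> from the dual into \<open>real^'n\<close> is onto: a
  nonzero vector orthogonal to its range would be a linear relation among the \<open>x i\<close>.
  Preimages of the unit vectors are then the required functionals.\<close>

lemma ex_biorthogonal_functionals:
  fixes x :: "'n::finite \<Rightarrow> 'a::real_normed_vector"
  assumes separates: "\<And>y::'a. y \<noteq> 0 \<Longrightarrow> \<exists>f :: 'a \<Rightarrow>\<^sub>L real. blinfun_apply f y \<noteq> 0"
    and x: "inj x" "independent (range x)"
  obtains f :: "'n \<Rightarrow> 'a \<Rightarrow>\<^sub>L real" where "\<And>i j. blinfun_apply (f j) (x i) = (if i = j then 1 else 0)"
proof -
  define E where "E f = (\<chi> i. blinfun_apply f (x i))" for f :: "'a \<Rightarrow>\<^sub>L real"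
  have "linear E"
    by (rule linearI) (auto simp: E_def vec_eq_iff blinfun.add_left blinfun.scaleR_left)
  then have sub: "subspace (range E)"
    by (simp add: linear_subspace_image)
  have "range E = UNIV"
  proof (rule ccontr)
    assume "range E \<noteq> UNIV"
    then have "span (range E) \<noteq> UNIV" by (metis sub span_eq_iff)
    then obtain a where a: "a \<noteq> 0" "\<forall>v \<in> span (range E). a \<bullet> v = 0"
      using span_not_UNIV_orthogonal by blast
    \<comment> \<open>Orthogonality of \<open>a\<close> to \<open>E f\<close> says that
      \<open>f\<close> kills the combination of the \<open>x i\<close> with coefficients
      \<open>a\<close>; separation then makes this combination zero.\<close>
    have "blinfun_apply f (\<Sum>i\<in>UNIV. (a $ i) *\<^sub>R x i) = 0" for f :: "'a \<Rightarrow>\<^sub>L real"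
    proof -
      have "a \<bullet> E f = 0" using a(2) by (simp add: span_base)
      then show ?thesis
        by (simp add: E_def inner_vec_def blinfun.sum_right blinfun.scaleR_right)
    qed
    then have "(\<Sum>i\<in>UNIV. (a $ i) *\<^sub>R x i) = 0" using separates by blast
    \<comment> \<open>Independence concerns the set \<open>range x\<close>, so the coefficients are
      moved from indices to vectors along \<open>inv x\<close>.\<close>
    moreover have "(\<Sum>v\<in>range x. (a $ inv x v) *\<^sub>R v) = (\<Sum>i\<in>UNIV. (a $ i) *\<^sub>R x i)"
      using x(1) by (simp add: sum.reindex)
    ultimately have "a $ inv x v = 0" if "v \<in> range x" for v
      using independentD[OF x(2), of "range x" "\<lambda>v. a $ inv x v" v] that by simp
    then have "a $ i = 0" for i using x(1) by (metis inv_f_f rangeI)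
    then show False using a(1) by (simp add: vec_eq_iff)
  qed
  then have "\<forall>j. \<exists>f. E f = axis j 1" by (metis UNIV_I image_iff)
  then obtain f where "\<And>j. E (f j) = axis j 1" by metis
  then have "blinfun_apply (f j) (x i) = (if i = j then 1 else 0)" for i j
    unfolding E_def by (simp add: vec_eq_iff axis_def)
  then show thesis by (rule that)
qed

text \<open>Scaling the biorthogonal functionals to norm 1 makes them admissible in the supremum;
  their matrix is diagonal with positive entries \<open>1 / norm (f j)\<close>.\<close>

lemma ex_gaehler_norm_pos:
  assumes "space_dim TYPE('a::real_normed_vector) \<ge> enat CARD('n::finite)"
    and "property_G TYPE('a)"
  obtains x :: "'n::finite \<Rightarrow> 'a::real_normed_vector" where "gaehler_norm x > 0"
proof -
  obtain x :: "'n \<Rightarrow> 'a" where x: "inj x" "independent (range x)"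
    using ex_independent_family[OF assms(1)] .
  have separates: "\<exists>f :: 'a \<Rightarrow>\<^sub>L real. blinfun_apply f y \<noteq> 0" if "y \<noteq> 0" for y
    using property_G_separates[OF assms(2) that] by metis
  obtain f :: "'n \<Rightarrow> 'a \<Rightarrow>\<^sub>L real"
    where f: "\<And>i j. blinfun_apply (f j) (x i) = (if i = j then 1 else 0)"
    by (rule ex_biorthogonal_functionals[OF separates x]) (assumption, rule that)
  have nz: "f j \<noteq> 0" for j
    using f[of j j] by auto
  define A :: "real^'n^'n" where "A = (\<chi> i j. blinfun_apply (f j /\<^sub>R norm (f j)) (x i))"
  have "det A = (\<Prod>i\<in>UNIV. A $ i $ i)"
    by (rule det_diagonal) (simp add: A_def blinfun.scaleR_left f)
  also have "\<dots> > 0"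
    using nz by (intro prod_pos) (simp add: A_def blinfun.scaleR_left f)
  finally have "0 < \<bar>det A\<bar>" by simp
  also have "\<dots> \<le> gaehler_norm x"
    unfolding A_def using nz by (intro abs_det_le_gaehler_norm) simp
  finally show thesis by (rule that)
qed

section \<open>The n-dual space\<close>

lemma multilinear_add:
  "multilinear f \<Longrightarrow> multilinear g \<Longrightarrow> multilinear (f + g)"
  unfolding multilinear_def plus_fun_def by (auto intro: linear_compose_add)

lemma multilinear_cmult:
  "multilinear f \<Longrightarrow> multilinear (\<lambda>x. c * f x)"
  unfolding multilinear_def by (simp add: linear_iff algebra_simps)

lemma multilinear_zero: "multilinear 0"
  by (auto simp: multilinear_def zero_fun_def linear_iff)

text \<open>Additivity and homogeneity in each slot are equations between finitely many values, so
  they survive pointwise limits.\<close>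

lemma multilinear_tendsto:
  assumes "\<And>k. multilinear (F k)" "\<And>x. (\<lambda>k. F k x) \<longlonglongrightarrow> f x"
  shows "multilinear f"
  unfolding multilinear_def
proof (intro allI linearI)
  fix x i a b and c :: real
  have lin: "linear (\<lambda>y. F k (x(i := y)))" for k
    using assms(1) by (simp add: multilinear_def)
  have "(\<lambda>k. F k (x(i := a + b))) \<longlonglongrightarrow> f (x(i := a)) + f (x(i := b))"
    unfolding linear_add[OF lin] by (intro tendsto_add assms(2))
  then show "f (x(i := a + b)) = f (x(i := a)) + f (x(i := b))"
    using assms(2) LIMSEQ_unique by blast
  have "(\<lambda>k. F k (x(i := c *\<^sub>R a))) \<longlonglongrightarrow> c *\<^sub>R f (x(i := a))"
    unfolding linear_scale[OF lin] by (intro tendsto_scaleR tendsto_const assms(2))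
  then show "f (x(i := c *\<^sub>R a)) = c *\<^sub>R f (x(i := a))"
    using assms(2) LIMSEQ_unique by blast
qed

lemma gaehler_boundedI:
  assumes "\<And>x. \<bar>f x\<bar> \<le> K * gaehler_norm x"
  shows "gaehler_bounded f"
  unfolding gaehler_bounded_def
\<comment> \<open>The definition asks for a positive constant; enlarging \<open>K\<close> is
  harmless because the Gaehler norm is nonnegative.\<close>
proof (intro exI[of _ "max K 1"] conjI allI)
  fix x
  show "\<bar>f x\<bar> \<le> max K 1 * gaehler_norm x"
    using assms[of x] mult_right_mono[of K "max K 1" "gaehler_norm x"] gaehler_norm_nonneg[of x]
    by linarith
qed simp

lemma gaehler_bounded_add:
  assumes "gaehler_bounded f" "gaehler_bounded g"
  shows "gaehler_bounded (f + g)"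
proof -
  obtain K L where "\<And>x. \<bar>f x\<bar> \<le> K * gaehler_norm x" "\<And>x. \<bar>g x\<bar> \<le> L * gaehler_norm x"
    using assms unfolding gaehler_bounded_def by metis
  then have "\<bar>(f + g) x\<bar> \<le> (K + L) * gaehler_norm x" for x
    unfolding plus_fun_apply distrib_right by (intro order_trans[OF abs_triangle_ineq] add_mono)
  then show ?thesis by (rule gaehler_boundedI)
qed

lemma gaehler_bounded_cmult:
  assumes "gaehler_bounded f"
  shows "gaehler_bounded (\<lambda>x. c * f x)"
proof -
  obtain K where "\<And>x. \<bar>f x\<bar> \<le> K * gaehler_norm x"
    using assms unfolding gaehler_bounded_def by metis
  then have "\<bar>c * f x\<bar> \<le> (\<bar>c\<bar> * K) * gaehler_norm x" for x
    by (simp add: abs_mult mult.assoc mult_left_mono)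
  then show ?thesis by (rule gaehler_boundedI)
qed

section \<open>The dual norm as the least bound, and the norm axioms\<close>

lemma abs_le_n_dual_norm:
  assumes "gaehler_bounded f"
  shows "\<bar>f x\<bar> \<le> n_dual_norm f * gaehler_norm x"
proof -
  obtain K where K: "\<And>x. \<bar>f x\<bar> \<le> K * gaehler_norm x"
    using assms unfolding gaehler_bounded_def by metis
  show ?thesis
  proof (cases "gaehler_norm x = 0")
    \<comment> \<open>The supremum ignores such tuples, but any bound \<open>K\<close> forces
      \<open>f x = 0\<close> there.\<close>
    case True
    then show ?thesis using K[of x] by simp
  next
    case False
    have pos: "gaehler_norm y > 0" if "gaehler_norm y \<noteq> 0" for y :: "'a \<Rightarrow> 'b"
      using gaehler_norm_nonneg[of y] that by simp
    have "bdd_above {\<bar>f x\<bar> / gaehler_norm x | x. gaehler_norm x \<noteq> 0}"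
      using K pos by (intro bdd_aboveI[of _ K]) (auto simp: divide_le_eq)
    then have "\<bar>f x\<bar> / gaehler_norm x \<le> n_dual_norm f"
      unfolding n_dual_norm_def using False by (intro cSup_upper) auto
    then show ?thesis using pos[OF False] by (simp add: divide_le_eq)
  qed
qed

text \<open>Together with \<open>abs_le_n_dual_norm\<close> this makes the dual norm the least
  bounding constant, from which the norm axioms follow. A tuple of positive norm is assumed because
  \<open>Sup\<close> of the empty set carries no information.\<close>

lemma n_dual_norm_least:
  fixes f :: "('n::finite \<Rightarrow> 'a::real_normed_vector) \<Rightarrow> real"
  assumes "\<exists>x :: 'n \<Rightarrow> 'a. gaehler_norm x > 0"
    and "\<And>x. \<bar>f x\<bar> \<le> K * gaehler_norm x"
  shows "n_dual_norm f \<le> K"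
  unfolding n_dual_norm_def
proof (rule cSup_least)
  show "{\<bar>f x\<bar> / gaehler_norm x | x. gaehler_norm x \<noteq> 0} \<noteq> {}"
    using assms(1) by fastforce
  show "y \<le> K" if "y \<in> {\<bar>f x\<bar> / gaehler_norm x | x. gaehler_norm x \<noteq> 0}" for y
    using that assms(2) gaehler_norm_nonneg by (force simp: divide_le_eq less_le)
qed

lemma n_dual_norm_nonneg:
  fixes f :: "('n::finite \<Rightarrow> 'a::real_normed_vector) \<Rightarrow> real"
  assumes "\<exists>x :: 'n \<Rightarrow> 'a. gaehler_norm x > 0" "gaehler_bounded f"
  shows "0 \<le> n_dual_norm f"
proof -
  obtain x :: "'n \<Rightarrow> 'a" where "gaehler_norm x > 0" using assms(1) by blast
  moreover have "0 \<le> n_dual_norm f * gaehler_norm x"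
    using abs_le_n_dual_norm[OF assms(2), of x] by linarith
  ultimately show ?thesis by (simp add: zero_le_mult_iff)
qed

lemma n_dual_norm_cmult_le:
  fixes f :: "('n::finite \<Rightarrow> 'a::real_normed_vector) \<Rightarrow> real"
  assumes "\<exists>x :: 'n \<Rightarrow> 'a. gaehler_norm x > 0" "gaehler_bounded f"
  shows "n_dual_norm (\<lambda>x. c * f x) \<le> \<bar>c\<bar> * n_dual_norm f"
  by (rule n_dual_norm_least[OF assms(1)])
     (simp add: abs_mult mult.assoc mult_left_mono abs_le_n_dual_norm[OF assms(2)])

lemma n_dual_norm_cmult:
  fixes f :: "('n::finite \<Rightarrow> 'a::real_normed_vector) \<Rightarrow> real"
  assumes "\<exists>x :: 'n \<Rightarrow> 'a. gaehler_norm x > 0" "gaehler_bounded f"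
  shows "n_dual_norm (\<lambda>x. c * f x) = \<bar>c\<bar> * n_dual_norm f"
proof (cases "c = 0")
  case True
  have "gaehler_bounded (\<lambda>x. c * f x)" by (rule gaehler_bounded_cmult[OF assms(2)])
  then show ?thesis
    using True n_dual_norm_nonneg[OF assms(1)] n_dual_norm_cmult_le[OF assms, of c]
    by fastforce
next
  case False
  \<comment> \<open>Applying the inequality already known to \<open>inverse c\<close> and
    \<open>c * f\<close> yields the reverse one.\<close>
  have "n_dual_norm (\<lambda>x. inverse c * (c * f x)) \<le> \<bar>inverse c\<bar> * n_dual_norm (\<lambda>x. c * f x)"
    by (intro n_dual_norm_cmult_le assms gaehler_bounded_cmult)
  then have "\<bar>c\<bar> * n_dual_norm f \<le> n_dual_norm (\<lambda>x. c * f x)"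
    using False by (simp add: field_simps)
  then show ?thesis using n_dual_norm_cmult_le[OF assms, of c] by simp
qed

lemma n_dual_norm_add_le:
  fixes f g :: "('n::finite \<Rightarrow> 'a::real_normed_vector) \<Rightarrow> real"
  assumes "\<exists>x :: 'n \<Rightarrow> 'a. gaehler_norm x > 0" "gaehler_bounded f" "gaehler_bounded g"
  shows "n_dual_norm (f + g) \<le> n_dual_norm f + n_dual_norm g"
proof (rule n_dual_norm_least[OF assms(1)])
  fix x
  show "\<bar>(f + g) x\<bar> \<le> (n_dual_norm f + n_dual_norm g) * gaehler_norm x"
    using abs_le_n_dual_norm[OF assms(2), of x] abs_le_n_dual_norm[OF assms(3), of x]
      abs_triangle_ineq[of "f x" "g x"]
    by (simp add: distrib_right)
qed

lemma n_dual_norm_eq_0_iff: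
  fixes f :: "('n::finite \<Rightarrow> 'a::real_normed_vector) \<Rightarrow> real"
  assumes "\<exists>x :: 'n \<Rightarrow> 'a. gaehler_norm x > 0" "gaehler_bounded f"
  shows "n_dual_norm f = 0 \<longleftrightarrow> f = 0"
proof
  assume "n_dual_norm f = 0"
  then show "f = 0" using abs_le_n_dual_norm[OF assms(2)] by (auto simp: fun_eq_iff)
next
  assume "f = 0"
  then have "f = (\<lambda>x. 0 * f x)" by (simp add: fun_eq_iff)
  then have "n_dual_norm f = \<bar>0\<bar> * n_dual_norm f"
    using n_dual_norm_cmult[OF assms, of 0] by metis
  then show "n_dual_norm f = 0" by simp
qed

lemma n_dual_add: "f \<in> n_dual \<Longrightarrow> g \<in> n_dual \<Longrightarrow> f + g \<in> n_dual"
  by (simp add: n_dual_def multilinear_add gaehler_bounded_add)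

lemma n_dual_cmult: "f \<in> n_dual \<Longrightarrow> (\<lambda>x. c * f x) \<in> n_dual"
  by (simp add: n_dual_def multilinear_cmult gaehler_bounded_cmult)

lemma n_dual_zero: "0 \<in> n_dual"
  by (auto simp: n_dual_def multilinear_zero intro: gaehler_boundedI[of _ 0])

lemma n_dual_diff:
  assumes "f \<in> n_dual" "g \<in> n_dual"
  shows "f - g \<in> n_dual"
proof -
  have "f - g = f + (\<lambda>x. (-1) * g x)" by (auto simp: fun_eq_iff)
  also have "\<dots> \<in> n_dual" by (intro n_dual_add n_dual_cmult assms)
  finally show ?thesis .
qed

section \<open>Completeness\<close>

lemma n_dual_complete:
  fixes F :: "nat \<Rightarrow> ('n::finite \<Rightarrow> 'a::real_normed_vector) \<Rightarrow> real"
  assumes ex: "\<exists>x :: 'n \<Rightarrow> 'a. gaehler_norm x > 0"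
    and F: "\<And>k. F k \<in> n_dual"
    and Cauchy: "\<And>e. e > 0 \<Longrightarrow> \<exists>K. \<forall>k\<ge>K. \<forall>l\<ge>K. n_dual_norm (F k - F l) < e"
  shows "\<exists>f\<in>n_dual. (\<lambda>k. n_dual_norm (F k - f)) \<longlonglongrightarrow> 0"
proof -
  have diff: "\<bar>F k x - F l x\<bar> \<le> n_dual_norm (F k - F l) * gaehler_norm x" for k l x
    using abs_le_n_dual_norm[of "F k - F l" x] n_dual_diff[OF F F] by (simp add: n_dual_def)
  have "Cauchy (\<lambda>k. F k x)" for x
  proof (rule metric_CauchyI)
    fix e :: real assume "e > 0"
    \<comment> \<open>The added 1 allows division by \<open>G\<close> even where the Gaehler norm of
      \<open>x\<close> vanishes.\<close>
    define G where "G = gaehler_norm x + 1"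
    have G: "G > 0" "gaehler_norm x \<le> G" using gaehler_norm_nonneg[of x] by (auto simp: G_def)
    obtain K where K: "n_dual_norm (F k - F l) < e / G" if "k \<ge> K" "l \<ge> K" for k l
      using Cauchy[of "e / G"] \<open>e > 0\<close> G by auto
    have "dist (F k x) (F l x) < e" if "k \<ge> K" "l \<ge> K" for k l
    proof -
      have "0 \<le> n_dual_norm (F k - F l)"
        using n_dual_norm_nonneg[OF ex] n_dual_diff[OF F F] by (simp add: n_dual_def)
      then have "\<bar>F k x - F l x\<bar> \<le> n_dual_norm (F k - F l) * G"
        using diff[of k x l] mult_left_mono[OF G(2)] by fastforce
      also have "\<dots> < e" using K[OF that] G(1) by (simp add: less_divide_eq)
      finally show ?thesis by (simp add: dist_real_def)
    qed
    then show "\<exists>K. \<forall>k\<ge>K. \<forall>l\<ge>K. dist (F k x) (F l x) < e" by blast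
  qed
  then have "\<forall>x. \<exists>y. (\<lambda>k. F k x) \<longlonglongrightarrow> y"
    using Cauchy_convergent convergent_def by blast
  then obtain f where f: "\<And>x. (\<lambda>k. F k x) \<longlonglongrightarrow> f x" by metis
  \<comment> \<open>Letting \<open>l\<close> tend to infinity in the Cauchy estimate keeps
    \<open>K\<close> independent of \<open>x\<close>. This uniformity gives both the boundedness of
    \<open>f\<close> and convergence in norm.\<close>
  have close: "\<exists>K. \<forall>k\<ge>K. \<forall>x. \<bar>F k x - f x\<bar> \<le> e * gaehler_norm x" if "e > 0" for e
  proof -
    obtain K where K: "n_dual_norm (F k - F l) < e" if "k \<ge> K" "l \<ge> K" for k l
      using Cauchy[OF \<open>e > 0\<close>] by auto
    have "\<bar>F k x - f x\<bar> \<le> e * gaehler_norm x" if "k \<ge> K" for k x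
    proof (rule tendsto_upperbound)
      show "(\<lambda>l. \<bar>F k x - F l x\<bar>) \<longlonglongrightarrow> \<bar>F k x - f x\<bar>"
        by (intro tendsto_intros f)
      have "\<bar>F k x - F l x\<bar> \<le> e * gaehler_norm x" if "l \<ge> K" for l
        using diff[of k x l] K[OF \<open>k \<ge> K\<close> that] gaehler_norm_nonneg[of x]
        by (meson less_imp_le mult_right_mono order_trans)
      then show "\<forall>\<^sub>F l in sequentially. \<bar>F k x - F l x\<bar> \<le> e * gaehler_norm x"
        by (auto simp: eventually_sequentially)
    qed simp
    then show ?thesis by blast
  qed
  have "f \<in> n_dual"
  proof -
    \<comment> \<open>A single term within distance 1 of \<open>f\<close> bounds \<open>f\<close> by
      \<open>n_dual_norm (F K) + 1\<close>.\<close>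
    obtain K where K: "\<And>x. \<bar>F K x - f x\<bar> \<le> 1 * gaehler_norm x"
      using close[of 1] by auto
    have "gaehler_bounded (F K)" using F by (simp add: n_dual_def)
    then have "\<bar>f x\<bar> \<le> (n_dual_norm (F K) + 1) * gaehler_norm x" for x
      using abs_le_n_dual_norm[of "F K" x] K[of x] by (simp add: distrib_right)
    then have "gaehler_bounded f" by (rule gaehler_boundedI)
    moreover have "multilinear f"
      by (rule multilinear_tendsto[OF _ f]) (use F in \<open>simp add: n_dual_def\<close>)
    ultimately show ?thesis by (simp add: n_dual_def)
  qed
  moreover have "(\<lambda>k. n_dual_norm (F k - f)) \<longlonglongrightarrow> 0"
  proof (rule LIMSEQ_I)
    fix r :: real assume "r > 0"
    \<comment> \<open>Passing to the supremum only preserves a weak inequality; \<open>r / 2\<close>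
      leaves room for the strict one.\<close>
    then obtain K where K: "\<And>k x. k \<ge> K \<Longrightarrow> \<bar>F k x - f x\<bar> \<le> r / 2 * gaehler_norm x"
      using close[of "r / 2"] by auto
    have "norm (n_dual_norm (F k - f) - 0) < r" if "k \<ge> K" for k
    proof -
      have "n_dual_norm (F k - f) \<le> r / 2"
        using K[OF that] by (intro n_dual_norm_least[OF ex]) simp
      moreover have "0 \<le> n_dual_norm (F k - f)"
        using n_dual_norm_nonneg[OF ex] n_dual_diff[OF F \<open>f \<in> n_dual\<close>] by (simp add: n_dual_def)
      ultimately show ?thesis using \<open>r > 0\<close> by simp
    qed
    then show "\<exists>K. \<forall>k\<ge>K. norm (n_dual_norm (F k - f) - 0) < r" by blast
  qed
  ultimately show ?thesis by blast
qed

theorem theorem4p7: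
  assumes "space_dim TYPE('a::real_normed_vector) \<ge> enat CARD('n::finite)"
    and "property_G TYPE('a)"
  shows "banach_space_on (\<lambda>c f x. c * f x)
           (n_dual :: (('n \<Rightarrow> 'a) \<Rightarrow> real) set) n_dual_norm"
proof -
  have ex: "\<exists>x :: 'n \<Rightarrow> 'a. gaehler_norm x > 0"
    using ex_gaehler_norm_pos[OF assms] by blast
  \<comment> \<open>The ambient space consists of all real functions on tuples. With its vector
    space laws settled, what remains is the subspace property, the four norm axioms and
    completeness.\<close>
  interpret vector_space "\<lambda>c (f :: ('n \<Rightarrow> 'a) \<Rightarrow> real) x. c * f x"
    by unfold_locales (auto simp: fun_eq_iff algebra_simps)
  show ?thesis
  proof (unfold_locales, goal_cases)
    case 1
    show ?case by (auto intro: subspaceI n_dual_zero n_dual_add n_dual_cmult)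
  next
    case (2 v)
    then show ?case using n_dual_norm_nonneg[OF ex] by (simp add: n_dual_def)
  next
    case (3 v)
    then show ?case using n_dual_norm_eq_0_iff[OF ex] by (simp add: n_dual_def)
  next
    case (4 v c)
    then show ?case using n_dual_norm_cmult[OF ex] by (simp add: n_dual_def)
  next
    case (5 u v)
    then show ?case using n_dual_norm_add_le[OF ex] by (simp add: n_dual_def)
  next
    case (6 F)
    then show ?case using n_dual_complete[OF ex] by blast
  qed
qed

end
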